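(* For a join-semilattice $N$ with $0$, $N^\Diamond$ is isomorphic to the lattice of finitely generated upsets of $N$ ordered by reverse inclusion.
   Context: For a join-semilattice $N$ with least element $0$, $N^\Diamond$ is the bounded distributive lattice freely generated by the set of symbols $\Diamond_a$ for $a\in N$ modulo the relations $\Diamond_0=0$ and $\Diamond_{a\vee b}=\Diamond_a\vee\Diamond_b$ for all $a,b\in N$. An upset $S$ of $N$ is finitely generated if $S={\uparrow}F=\{x\in N\mid x\ge s\text{ for some }s\in F\}$ for some finite (possibly empty) $F\subseteq N$. *)

theory Defs
  imports Main
begin

definition bounded_lattice_hom :: "('a::bounded_lattice \<Rightarrow> 'b::bounded_lattice) \<Rightarrow> bool" where
  "bounded_lattice_hom f \<longleftrightarrow>
     f bot = bot \<and> f top = top \<and>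
     (\<forall>x y. f (inf x y) = inf (f x) (f y)) \<and>
     (\<forall>x y. f (sup x y) = sup (f x) (f y))"

definition bounded_lattice_iso :: "('a::bounded_lattice \<Rightarrow> 'b::bounded_lattice) \<Rightarrow> bool" where
  "bounded_lattice_iso f \<longleftrightarrow> bounded_lattice_hom f \<and> bij f"

text \<open>The presentation is realised as in universal algebra: terms in the signature of bounded
  lattices over the generators, modulo the least congruence containing the axioms of bounded
  distributive lattices and the two families of defining relations.\<close>

datatype 'a lterm =
    Gen 'a
  | Zero
  | One
  | Meet "'a lterm" "'a lterm"
  | Join "'a lterm" "'a lterm"

inductive lcong :: "'a::bounded_semilattice_sup_bot lterm \<Rightarrow> 'a lterm \<Rightarrow> bool" where
  lc_refl: "lcong s s"
| lc_sym: "lcong s t \<Longrightarrow> lcong t s"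
| lc_trans: "lcong s t \<Longrightarrow> lcong t u \<Longrightarrow> lcong s u"
| lc_Meet: "lcong s s' \<Longrightarrow> lcong t t' \<Longrightarrow> lcong (Meet s t) (Meet s' t')"
| lc_Join: "lcong s s' \<Longrightarrow> lcong t t' \<Longrightarrow> lcong (Join s t) (Join s' t')"
| lc_Meet_assoc: "lcong (Meet (Meet s t) u) (Meet s (Meet t u))"
| lc_Join_assoc: "lcong (Join (Join s t) u) (Join s (Join t u))"
| lc_Meet_comm: "lcong (Meet s t) (Meet t s)"
| lc_Join_comm: "lcong (Join s t) (Join t s)"
| lc_Meet_absorb: "lcong (Meet s (Join s t)) s"
| lc_Join_absorb: "lcong (Join s (Meet s t)) s"
| lc_distrib: "lcong (Join s (Meet t u)) (Meet (Join s t) (Join s u))"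
| lc_Join_Zero: "lcong (Join Zero s) s"
| lc_Meet_One: "lcong (Meet One s) s"
| lc_Gen_bot: "lcong (Gen bot) Zero"
| lc_Gen_sup: "lcong (Gen (sup a b)) (Join (Gen a) (Gen b))"

quotient_type (overloaded) 'a diamond = "'a::bounded_semilattice_sup_bot lterm" / lcong
  by (rule equivpI) (auto simp: reflp_def symp_def transp_def intro: lc_refl lc_sym lc_trans)

lift_definition Dia :: "'a::bounded_semilattice_sup_bot \<Rightarrow> 'a diamond" is Gen .

instantiation diamond :: (bounded_semilattice_sup_bot) "{distrib_lattice, bounded_lattice}"
begin

lift_definition bot_diamond :: "'a diamond" is Zero .
lift_definition top_diamond :: "'a diamond" is One .
lift_definition inf_diamond :: "'a diamond \<Rightarrow> 'a diamond \<Rightarrow> 'a diamond" is Meet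
  by (rule lc_Meet)
lift_definition sup_diamond :: "'a diamond \<Rightarrow> 'a diamond \<Rightarrow> 'a diamond" is Join
  by (rule lc_Join)

definition less_eq_diamond :: "'a diamond \<Rightarrow> 'a diamond \<Rightarrow> bool" where
  "less_eq_diamond x y \<longleftrightarrow> inf x y = x"
definition less_diamond :: "'a diamond \<Rightarrow> 'a diamond \<Rightarrow> bool" where
  "less_diamond x y \<longleftrightarrow> x \<le> y \<and> x \<noteq> y"

instance
proof
  fix x y z :: "'a diamond"
  have ia: "inf (inf u v) w = inf u (inf v w)" for u v w :: "'a diamond"
    by transfer (rule lc_Meet_assoc)
  have sa: "sup (sup u v) w = sup u (sup v w)" for u v w :: "'a diamond"
    by transfer (rule lc_Join_assoc)
  have ic: "inf u v = inf v u" for u v :: "'a diamond"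
    by transfer (rule lc_Meet_comm)
  have sc: "sup u v = sup v u" for u v :: "'a diamond"
    by transfer (rule lc_Join_comm)
  have iab: "inf u (sup u v) = u" for u v :: "'a diamond"
    by transfer (rule lc_Meet_absorb)
  have sab: "sup u (inf u v) = u" for u v :: "'a diamond"
    by transfer (rule lc_Join_absorb)
  have b: "sup bot u = u" for u :: "'a diamond"
    by transfer (rule lc_Join_Zero)
  have t: "inf top u = u" for u :: "'a diamond"
    by transfer (rule lc_Meet_One)
  have ii: "inf u u = u" for u :: "'a diamond"
    by (metis iab sab)
  have le_sup: "u \<le> v \<longleftrightarrow> sup u v = v" for u v :: "'a diamond"
    unfolding less_eq_diamond_def by (metis iab sab ic sc)
  show "(x < y) = (x \<le> y \<and> \<not> y \<le> x)"
    unfolding less_diamond_def less_eq_diamond_def by (metis ic ii)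
  show "x \<le> x"
    by (simp add: less_eq_diamond_def ii)
  show "x \<le> z" if "x \<le> y" "y \<le> z"
    using that unfolding less_eq_diamond_def by (metis ia)
  show "x = y" if "x \<le> y" "y \<le> x"
    using that unfolding less_eq_diamond_def by (metis ic)
  show "inf x y \<le> x" "inf x y \<le> y"
    unfolding less_eq_diamond_def by (metis ia ic ii)+
  show "x \<le> inf y z" if "x \<le> y" "x \<le> z"
    using that unfolding less_eq_diamond_def by (metis ia)
  show "x \<le> sup x y" "y \<le> sup x y"
    unfolding less_eq_diamond_def by (metis iab sc)+
  show "sup y z \<le> x" if "y \<le> x" "z \<le> x"
    using that unfolding le_sup by (metis sa)
  show "sup x (inf y z) = inf (sup x y) (sup x z)"
    by transfer (rule lc_distrib)
  show "bot \<le> x"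
    by (simp add: le_sup b)
  show "x \<le> top"
    unfolding less_eq_diamond_def by (metis t ic)
qed

end

lemma Dia_bot: "Dia bot = bot"
  by transfer (rule lc_Gen_bot)

lemma Dia_sup: "Dia (sup a b) = sup (Dia a) (Dia b)"
  by transfer (rule lc_Gen_sup)

primrec leval :: "('a \<Rightarrow> 'b::bounded_lattice) \<Rightarrow> 'a lterm \<Rightarrow> 'b" where
  "leval \<phi> (Gen a) = \<phi> a"
| "leval \<phi> Zero = bot"
| "leval \<phi> One = top"
| "leval \<phi> (Meet s t) = inf (leval \<phi> s) (leval \<phi> t)"
| "leval \<phi> (Join s t) = sup (leval \<phi> s) (leval \<phi> t)"

lemma leval_lcong:
  fixes \<phi> :: "'a::bounded_semilattice_sup_bot \<Rightarrow> 'b::{distrib_lattice, bounded_lattice}"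
  assumes "\<phi> bot = bot" and "\<And>a b. \<phi> (sup a b) = sup (\<phi> a) (\<phi> b)"
  shows "lcong s t \<Longrightarrow> leval \<phi> s = leval \<phi> t"
proof (induction rule: lcong.induct)
  case (lc_Meet_comm s t)
  show ?case by (simp add: inf.commute)
next
  case (lc_Join_comm s t)
  show ?case by (simp add: sup.commute)
next
  case (lc_distrib s t u)
  show ?case by (simp add: sup_inf_distrib1)
qed (simp_all add: assms inf.assoc sup.assoc)

theorem diamond_universal:
  fixes \<phi> :: "'a::bounded_semilattice_sup_bot \<Rightarrow> 'b::{distrib_lattice, bounded_lattice}"
  assumes "\<phi> bot = bot" and "\<And>a b. \<phi> (sup a b) = sup (\<phi> a) (\<phi> b)"
  shows "\<exists>!h. bounded_lattice_hom h \<and> (\<forall>a. h (Dia a) = \<phi> a)"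
proof (rule ex_ex1I)
  let ?h = "\<lambda>x. leval \<phi> (rep_diamond x)"
  have ev: "leval \<phi> (rep_diamond (abs_diamond t)) = leval \<phi> t" for t
    by (rule leval_lcong[OF assms])
      (rule Quotient3_rep_abs[OF Quotient3_diamond lc_refl])
  have "bounded_lattice_hom ?h"
    unfolding bounded_lattice_hom_def
  proof (intro conjI allI)
    show "?h bot = bot" "?h top = top"
      by (simp_all add: bot_diamond_def top_diamond_def ev)
    show "?h (inf x y) = inf (?h x) (?h y)" "?h (sup x y) = sup (?h x) (?h y)" for x y
      by (simp_all add: inf_diamond_def sup_diamond_def map_fun_def ev)
  qed
  moreover have "\<forall>a. ?h (Dia a) = \<phi> a"
    by (simp add: Dia_def map_fun_def ev)
  ultimately show "\<exists>h. bounded_lattice_hom h \<and> (\<forall>a. h (Dia a) = \<phi> a)"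
    by blast
next
  fix h h' :: "'a diamond \<Rightarrow> 'b"
  assume h: "bounded_lattice_hom h \<and> (\<forall>a. h (Dia a) = \<phi> a)"
    and h': "bounded_lattice_hom h' \<and> (\<forall>a. h' (Dia a) = \<phi> a)"
  have "g (abs_diamond t) = leval \<phi> t"
    if g: "bounded_lattice_hom g \<and> (\<forall>a. g (Dia a) = \<phi> a)" for g t
  proof (induction t)
    case (Gen a)
    then show ?case using g by (simp flip: Dia.abs_eq)
  next
    case Zero
    then show ?case using g by (simp add: bounded_lattice_hom_def flip: bot_diamond.abs_eq)
  next
    case One
    then show ?case using g by (simp add: bounded_lattice_hom_def flip: top_diamond.abs_eq)
  next
    case (Meet s t)
    then show ?case using g by (simp add: bounded_lattice_hom_def flip: inf_diamond.abs_eq)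
  next
    case (Join s t)
    then show ?case using g by (simp add: bounded_lattice_hom_def flip: sup_diamond.abs_eq)
  qed
  note eq = this
  show "h = h'"
  proof (rule ext)
    fix x
    show "h x = h' x"
      by (induction x rule: diamond.abs_induct) (simp add: eq[OF h] eq[OF h'])
  qed
qed

definition up :: "'a::order set \<Rightarrow> 'a set" where
  "up F = {x. \<exists>s\<in>F. s \<le> x}"

typedef (overloaded) 'a fg_upset = "{S :: 'a::order set. \<exists>F. finite F \<and> S = up F}"
  morphisms set_of_fg_upset Abs_fg_upset
  by blast

setup_lifting type_definition_fg_upset

lemma up_inter:
  fixes F G :: "'a::semilattice_sup set"
  shows "up F \<inter> up G = up ((\<lambda>(a, b). sup a b) ` (F \<times> G))"
proof (intro equalityI subsetI)
  fix x assume "x \<in> up F \<inter> up G"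
  then obtain a b where "a \<in> F" "a \<le> x" "b \<in> G" "b \<le> x"
    by (auto simp: up_def)
  then show "x \<in> up ((\<lambda>(a, b). sup a b) ` (F \<times> G))"
    unfolding up_def by (intro CollectI bexI[of _ "sup a b"]) auto
qed (auto simp: up_def)

text \<open>The order is reverse inclusion, so joins are intersections, meets are unions,
  the whole semilattice is the least and the empty upset the greatest element.\<close>

instantiation fg_upset :: (bounded_semilattice_sup_bot) bounded_lattice
begin

lift_definition less_eq_fg_upset :: "'a fg_upset \<Rightarrow> 'a fg_upset \<Rightarrow> bool"
  is "\<lambda>S T. T \<subseteq> S" .
lift_definition less_fg_upset :: "'a fg_upset \<Rightarrow> 'a fg_upset \<Rightarrow> bool"
  is "\<lambda>S T. T \<subset> S" .
lift_definition sup_fg_upset :: "'a fg_upset \<Rightarrow> 'a fg_upset \<Rightarrow> 'a fg_upset" is "(\<inter>)"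
  using up_inter by (metis finite_cartesian_product finite_imageI)
lift_definition inf_fg_upset :: "'a fg_upset \<Rightarrow> 'a fg_upset \<Rightarrow> 'a fg_upset" is "(\<union>)"
proof -
  fix S T :: "'a set"
  assume "\<exists>F. finite F \<and> S = up F" "\<exists>F. finite F \<and> T = up F"
  then obtain F G where "finite F" "S = up F" "finite G" "T = up G" by blast
  moreover have "up F \<union> up G = up (F \<union> G)" by (auto simp: up_def)
  ultimately show "\<exists>F. finite F \<and> S \<union> T = up F" by (metis finite_UnI)
qed
lift_definition bot_fg_upset :: "'a fg_upset" is UNIV
  by (rule exI[of _ "{bot}"]) (simp add: up_def)
lift_definition top_fg_upset :: "'a fg_upset" is "{}"
  by (rule exI[of _ "{}"]) (simp add: up_def)

instance
  by standard (transfer, blast)+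

end

end

(*
  By distributivity every element of the free lattice is a finite meet of generators Dia a,
  because Dia turns the join of two generators into a generator. The homomorphism induced by
  a |-> up {a} sends the meet of Dia ` F to up F, hence is onto; it is injective because
  up F = up G makes every element of F lie above one of G and vice versa, so that the two
  meets coincide by monotonicity of Dia.
*)
theory Submission
  imports Defs
begin

text \<open>\<open>diamond_universal\<close> asks for a distributive codomain.\<close>

instance fg_upset :: (bounded_semilattice_sup_bot) distrib_lattice
  by standard (transfer, blast)

lemma Dia_mono: "a \<le> b \<Longrightarrow> Dia a \<le> Dia b"
  by (metis Dia_sup le_iff_sup)

text \<open>The element \<open>top\<close> makes the empty meet meaningful for \<open>Inf_fin\<close>.\<close>

definition meet_Dia :: "'a::bounded_semilattice_sup_bot set \<Rightarrow> 'a diamond" where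
  "meet_Dia F = Inf_fin (insert top (Dia ` F))"

lemma meet_Dia_empty: "meet_Dia {} = top"
  by (simp add: meet_Dia_def)

lemma meet_Dia_insert: "finite F \<Longrightarrow> meet_Dia (insert a F) = inf (Dia a) (meet_Dia F)"
  \<comment> \<open>Moving \<open>top\<close> inwards lets \<open>Dia a\<close> be split off from a
    set that is still nonempty.\<close>
  unfolding meet_Dia_def by (simp add: insert_commute[of top])

lemma meet_Dia_Un: "finite F \<Longrightarrow> finite G \<Longrightarrow> meet_Dia (F \<union> G) = inf (meet_Dia F) (meet_Dia G)"
  by (induction F rule: finite_induct) (simp_all add: meet_Dia_empty meet_Dia_insert inf.assoc)

text \<open>Distributivity turns a join of finite meets into the meet of all pairwise joins, and
  \<open>Dia_sup\<close> makes each of these a generator again.\<close>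

lemma meet_Dia_sup:
  assumes "finite F" "finite G"
  shows "meet_Dia ((\<lambda>(a, b). sup a b) ` (F \<times> G)) = sup (meet_Dia F) (meet_Dia G)"
proof -
  \<comment> \<open>Every pair involving \<open>top\<close> has join \<open>top\<close>, so only the
    pairs from \<open>F \<times> G\<close> add anything else.\<close>
  have "{sup x y |x y. x \<in> insert top (Dia ` F) \<and> y \<in> insert top (Dia ` G)}
      = insert top ((\<lambda>(a, b). sup (Dia a) (Dia b)) ` (F \<times> G))"
    by force
  also have "\<dots> = insert top (Dia ` (\<lambda>(a, b). sup a b) ` (F \<times> G))"
    by (simp add: image_image split_def Dia_sup)
  finally have "{sup x y |x y. x \<in> insert top (Dia ` F) \<and> y \<in> insert top (Dia ` G)}
      = insert top (Dia ` (\<lambda>(a, b). sup a b) ` (F \<times> G))" .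
  then show ?thesis
    unfolding meet_Dia_def using assms by (subst sup_Inf2_distrib) simp_all
qed

text \<open>Used in both directions, this yields injectivity: \<open>meet_Dia F\<close> depends only
  on \<open>up F\<close>.\<close>

lemma meet_Dia_antimono:
  assumes "finite F" "finite G" "up F \<subseteq> up G"
  shows "meet_Dia G \<le> meet_Dia F"
proof -
  have "meet_Dia G \<le> Dia a" if "a \<in> F" for a
  proof -
    have "a \<in> up G"
      using assms(3) that by (fastforce simp: up_def)
    then obtain b where "b \<in> G" "b \<le> a"
      by (auto simp: up_def)
    moreover have "meet_Dia G \<le> Dia b"
      unfolding meet_Dia_def using assms \<open>b \<in> G\<close> by (intro Inf_fin.coboundedI) auto
    ultimately show ?thesis
      using Dia_mono order_trans by blast
  qed
  then show ?thesis
    unfolding meet_Dia_def[of F] using assms by (subst Inf_fin.bounded_iff) auto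
qed

text \<open>Induction on a representing term: finite meets of generators include both bounds and are
  closed under meet and join.\<close>

lemma diamond_eq_meet_Dia:
  fixes x :: "'a::bounded_semilattice_sup_bot diamond"
  obtains F where "finite F" "x = meet_Dia F"
proof -
  have "\<exists>F. finite F \<and> abs_diamond t = meet_Dia F" for t :: "'a lterm"
  proof (induction t)
    case (Gen a)
    have "Dia a = meet_Dia {a}"
      by (simp add: meet_Dia_insert meet_Dia_empty)
    then show ?case
      by (metis Dia.abs_eq finite.emptyI finite_insert)
  next
    case Zero
    have "bot = meet_Dia {bot :: 'a}"
      by (simp add: meet_Dia_insert Dia_bot)
    then show ?case
      by (metis bot_diamond.abs_eq finite.emptyI finite_insert)
  next
    case One
    then show ?case
      by (metis top_diamond.abs_eq finite.emptyI meet_Dia_empty)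
  next
    case (Meet s t)
    then show ?case
      by (metis inf_diamond.abs_eq finite_UnI meet_Dia_Un)
  next
    case (Join s t)
    then show ?case
      by (metis sup_diamond.abs_eq finite_cartesian_product finite_imageI meet_Dia_sup)
  qed
  moreover have "\<exists>t. x = abs_diamond t"
    by (induction x rule: diamond.abs_induct) blast
  ultimately show thesis
    using that by blast
qed

lift_definition principal_upset :: "'a::order \<Rightarrow> 'a fg_upset" is "\<lambda>a. up {a}"
  by blast

text \<open>Under reverse inclusion meets are unions, and \<open>up F\<close> is the union of the
  \<open>up {a}\<close> for \<open>a\<close> in \<open>F\<close>; the empty meet goes to the empty
  upset.\<close>

lemma set_of_hom_meet_Dia:
  assumes "bounded_lattice_hom h" "\<And>a. h (Dia a) = principal_upset a" "finite F"
  shows "set_of_fg_upset (h (meet_Dia F)) = up F"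
  using assms(3)
proof (induction F rule: finite_induct)
  case empty
  show ?case
    using assms(1)
    by (simp add: meet_Dia_empty bounded_lattice_hom_def top_fg_upset.rep_eq up_def)
next
  case (insert a F)
  have "set_of_fg_upset (h (meet_Dia (insert a F))) = up {a} \<union> up F"
    using assms(1,2) insert
    by (simp add: meet_Dia_insert bounded_lattice_hom_def inf_fg_upset.rep_eq
        principal_upset.rep_eq)
  then show ?case
    by (auto simp: up_def)
qed

theorem corollary3p12:
  "\<exists>f :: 'a::bounded_semilattice_sup_bot diamond \<Rightarrow> 'a fg_upset. bounded_lattice_iso f"
proof -
  have "principal_upset (bot :: 'a) = bot"
    by transfer (simp add: up_def)
  moreover have "principal_upset (sup a b) = sup (principal_upset a) (principal_upset b)"
    for a b :: 'a
    by transfer (auto simp: up_def)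
  ultimately obtain h :: "'a diamond \<Rightarrow> 'a fg_upset"
    where h: "bounded_lattice_hom h" "\<And>a. h (Dia a) = principal_upset a"
    using diamond_universal[of principal_upset] by blast
  note set_h = set_of_hom_meet_Dia[OF h]
  have "inj h"
  proof (rule injI)
    fix x y assume "h x = h y"
    obtain F G where F: "finite F" "x = meet_Dia F" and G: "finite G" "y = meet_Dia G"
      by (metis diamond_eq_meet_Dia)
    have "up F = up G"
      using \<open>h x = h y\<close> F G set_h by metis
    then show "x = y"
      using F G by (simp add: meet_Dia_antimono order_antisym)
  qed
  moreover have "surj h"
  proof -
    \<comment> \<open>If the set of \<open>S\<close> is \<open>up F\<close> with \<open>F\<close>
      finite, then \<open>meet_Dia F\<close> is a preimage.\<close>
    have "\<exists>x. S = h x" for S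
      using set_of_fg_upset[of S] set_h set_of_fg_upset_inject by fastforce
    then show ?thesis
      by (simp add: surj_def)
  qed
  ultimately show ?thesis
    using h(1) by (auto simp: bounded_lattice_iso_def bij_def)
qed

end
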